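(* Let $X$ be a compact metric space and let $(X,F)$ be a topological dynamical system. Then $h_{se}(X,F)\le h(X,F)$.
   Context: Let $(X,d)$ be a compact metric space and $2^X$ the set of all non-empty subsets of $X$. A topological dynamical system $(X,F)$ is a set-valued function $F:X\to 2^X$ such that $F(x)$ is a non-empty compact set for each $x\in X$. For $x\in X$ and $n\in\mathbb{N}$ let $\Sigma_n(x)=\{(x_0,\dots,x_{n-1})\in X^n: x_0=x,\ x_{i+1}\in F(x_i)\text{ for }0\le i<n-1\}$ and $\mathrm{Orb}_n(X,F)=\bigcup_{x\in X}\Sigma_n(x)$, with metric $D_n(\overline{x},\overline{y})=\max_{0\le i<n}d(x_i,y_i)$. Topological entropy $h(X,F)$: a set $E\subset \mathrm{Orb}_n(X,F)$ is $(n,\epsilon)$-separated if $D_n(\overline{x},\overline{y})>\epsilon$ for all distinct $\overline{x},\overline{y}\in E$; it is $(n,\epsilon)$-spanning if for every $\overline{x}\in \mathrm{Orb}_n(X,F)$ there is $\overline{y}\in E$ with $D_n(\overline{x},\overline{y})<\epsilon$. Let $s_n(\epsilon)$ be the supremum of cardinalities of $(n,\epsilon)$-separated sets and $r_n(\epsilon)$ the infimum of cardinalities of $(n,\epsilon)$-spanning sets. Then $$h(X,F)=\lim_{\epsilon\to0}\limsup_{n\to\infty}\frac1n\log r_n(\epsilon)=\lim_{\epsilon\to0}\limsup_{n\to\infty}\frac1n\log s_n(\epsilon)$$ (the two expressions are known to coincide). Separated entropy $h_{se}(X,F)$: let $d_n(x,y)=\inf\{D_n(\overline{x},\overline{y}):\overline{x}\in\Sigma_n(x),\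 \overline{y}\in\Sigma_n(y)\}$ for $x,y\in X$ (in general only a semi-metric) and $B_n[x,\epsilon]=\{y\in X: d_n(x,y)\le\epsilon\}$. A set $E\subset X$ is $(d_n,\epsilon)$-separated if $B_n[x,\epsilon]\cap E=\{x\}$ for all $x\in E$. Let $S_n(\epsilon)$ be the largest cardinality of a $(d_n,\epsilon)$-separated set. Then $$h_{se}(X,F)=\lim_{\epsilon\to0}\limsup_{n\to\infty}\frac1n\log S_n(\epsilon).$$ *)

theory Defs
  imports "HOL-Analysis.Analysis"
begin

text \<open>
  The space \<open>X\<close> is a subset of a type of class \<^class>\<open>metric_space\<close> and carries the metric
  \<^const>\<open>dist\<close>.  Values of \<open>F\<close> outside \<open>X\<close> are irrelevant.  No continuity of \<open>F\<close> is required.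
\<close>

definition top_dyn_system :: "'a::metric_space set \<Rightarrow> ('a \<Rightarrow> 'a set) \<Rightarrow> bool" where
  "top_dyn_system X F \<longleftrightarrow>
     compact X \<and> (\<forall>x\<in>X. F x \<noteq> {} \<and> F x \<subseteq> X \<and> compact (F x))"

text \<open>
  Points of \<open>X\<^sup>n\<close> are lists of length \<open>n\<close> over \<open>X\<close>.  The definitions up to and including
  \<open>orbit_semidist\<close> are meaningful for \<open>n \<ge> 1\<close> only; the value at \<open>n = 0\<close> does not affect the
  upper limits below.
\<close>

definition orbits_from :: "'a set \<Rightarrow> ('a \<Rightarrow> 'a set) \<Rightarrow> nat \<Rightarrow> 'a \<Rightarrow> 'a list set" where
  "orbits_from X F n x =
     {xs. length xs = n \<and> set xs \<subseteq> X \<and> xs ! 0 = x \<and> (\<forall>i. Suc i < n \<longrightarrow> xs ! Suc i \<in> F (xs ! i))}"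

definition orbits :: "'a set \<Rightarrow> ('a \<Rightarrow> 'a set) \<Rightarrow> nat \<Rightarrow> 'a list set" where
  "orbits X F n = (\<Union>x\<in>X. orbits_from X F n x)"

definition orbit_dist :: "nat \<Rightarrow> 'a::metric_space list \<Rightarrow> 'a list \<Rightarrow> real" where
  "orbit_dist n xs ys = (MAX i\<in>{..<n}. dist (xs ! i) (ys ! i))"

definition orbit_semidist ::
    "'a::metric_space set \<Rightarrow> ('a \<Rightarrow> 'a set) \<Rightarrow> nat \<Rightarrow> 'a \<Rightarrow> 'a \<Rightarrow> real" where
  "orbit_semidist X F n x y =
     Inf {orbit_dist n xs ys | xs ys. xs \<in> orbits_from X F n x \<and> ys \<in> orbits_from X F n y}"

definition orbit_semiball ::
    "'a::metric_space set \<Rightarrow> ('a \<Rightarrow> 'a set) \<Rightarrow> nat \<Rightarrow> 'a \<Rightarrow> real \<Rightarrow> 'a set" where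
  "orbit_semiball X F n x \<epsilon> = {y \<in> X. orbit_semidist X F n x y \<le> \<epsilon>}"

definition ecard :: "'a set \<Rightarrow> enat" where
  "ecard A = (if finite A then enat (card A) else \<infinity>)"

definition elog :: "enat \<Rightarrow> ereal" where
  "elog c = (case c of enat k \<Rightarrow> if k = 0 then - \<infinity> else ereal (ln (real k)) | \<infinity> \<Rightarrow> \<infinity>)"

definition growth_rate :: "(nat \<Rightarrow> enat) \<Rightarrow> ereal" where
  "growth_rate c = limsup (\<lambda>n. elog (c n) / ereal (real n))"

definition orbit_separated ::
    "'a::metric_space set \<Rightarrow> ('a \<Rightarrow> 'a set) \<Rightarrow> nat \<Rightarrow> real \<Rightarrow> 'a list set \<Rightarrow> bool" where
  "orbit_separated X F n \<epsilon> E \<longleftrightarrow>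
     E \<subseteq> orbits X F n \<and> (\<forall>xs\<in>E. \<forall>ys\<in>E. xs \<noteq> ys \<longrightarrow> orbit_dist n xs ys > \<epsilon>)"

definition orbit_spanning ::
    "'a::metric_space set \<Rightarrow> ('a \<Rightarrow> 'a set) \<Rightarrow> nat \<Rightarrow> real \<Rightarrow> 'a list set \<Rightarrow> bool" where
  "orbit_spanning X F n \<epsilon> E \<longleftrightarrow>
     E \<subseteq> orbits X F n \<and> (\<forall>xs\<in>orbits X F n. \<exists>ys\<in>E. orbit_dist n xs ys < \<epsilon>)"

definition sep_number :: "'a::metric_space set \<Rightarrow> ('a \<Rightarrow> 'a set) \<Rightarrow> nat \<Rightarrow> real \<Rightarrow> enat" where
  "sep_number X F n \<epsilon> = Sup {ecard E | E. orbit_separated X F n \<epsilon> E}"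

definition span_number :: "'a::metric_space set \<Rightarrow> ('a \<Rightarrow> 'a set) \<Rightarrow> nat \<Rightarrow> real \<Rightarrow> enat" where
  "span_number X F n \<epsilon> = Inf {ecard E | E. orbit_spanning X F n \<epsilon> E}"

definition top_entropy :: "'a::metric_space set \<Rightarrow> ('a \<Rightarrow> 'a set) \<Rightarrow> ereal" where
  "top_entropy X F = Lim (at_right 0) (\<lambda>\<epsilon>. growth_rate (\<lambda>n. span_number X F n \<epsilon>))"

definition semidist_separated ::
    "'a::metric_space set \<Rightarrow> ('a \<Rightarrow> 'a set) \<Rightarrow> nat \<Rightarrow> real \<Rightarrow> 'a set \<Rightarrow> bool" where
  "semidist_separated X F n \<epsilon> E \<longleftrightarrow>
     E \<subseteq> X \<and> (\<forall>x\<in>E. orbit_semiball X F n x \<epsilon> \<inter> E = {x})"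

text \<open>The supremum is attained: by total boundedness of \<open>X\<close>, the cardinalities are bounded
  for \<open>\<epsilon> > 0\<close> and \<open>n \<ge> 1\<close>.\<close>

definition semidist_sep_number ::
    "'a::metric_space set \<Rightarrow> ('a \<Rightarrow> 'a set) \<Rightarrow> nat \<Rightarrow> real \<Rightarrow> enat" where
  "semidist_sep_number X F n \<epsilon> = Sup {ecard E | E. semidist_separated X F n \<epsilon> E}"

definition sep_entropy :: "'a::metric_space set \<Rightarrow> ('a \<Rightarrow> 'a set) \<Rightarrow> ereal" where
  "sep_entropy X F = Lim (at_right 0) (\<lambda>\<epsilon>. growth_rate (\<lambda>n. semidist_sep_number X F n \<epsilon>))"

text \<open>The limits exist by monotonicity, and topological entropy may equally be computed from
  separated sets.\<close>

lemma elog_mono: "a \<le> b \<Longrightarrow> elog a \<le> elog b"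
  by (auto simp: elog_def split: enat.splits)

lemma growth_rate_mono:
  assumes "\<And>n. n > 0 \<Longrightarrow> a n \<le> b n"
  shows "growth_rate a \<le> growth_rate b"
  unfolding growth_rate_def
proof (rule Limsup_mono)
  show "\<forall>\<^sub>F n in sequentially. elog (a n) / ereal (real n) \<le> elog (b n) / ereal (real n)"
    using eventually_gt_at_top[of 0]
    by eventually_elim (intro ereal_divide_right_mono elog_mono assms, auto)
qed

lemma tendsto_at_right_SUP:
  fixes g :: "real \<Rightarrow> ereal"
  assumes "\<And>a b. 0 < a \<Longrightarrow> a \<le> b \<Longrightarrow> g b \<le> g a"
  shows "(g \<longlongrightarrow> (SUP \<epsilon>\<in>{0<..}. g \<epsilon>)) (at_right 0)"
proof (rule order_tendstoI)
  fix l assume "l < (SUP \<epsilon>\<in>{0<..}. g \<epsilon>)"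
  then obtain e where e: "e > 0" "l < g e"
    by (auto simp: less_SUP_iff)
  show "\<forall>\<^sub>F x in at_right 0. l < g x"
    using eventually_at_right_real[OF e(1)]
    by eventually_elim (use e assms in \<open>force intro: less_le_trans\<close>)
next
  fix u assume u: "(SUP \<epsilon>\<in>{0<..}. g \<epsilon>) < u"
  have "\<forall>\<^sub>F x::real in at_right 0. x > 0"
    by (simp add: eventually_at_right_less)
  then show "\<forall>\<^sub>F x in at_right 0. g x < u"
    by eventually_elim (use u in \<open>auto intro: le_less_trans[OF SUP_upper]\<close>)
qed

lemma Lim_at_right_SUP:
  fixes g :: "real \<Rightarrow> ereal"
  assumes "\<And>a b. 0 < a \<Longrightarrow> a \<le> b \<Longrightarrow> g b \<le> g a"
  shows "Lim (at_right 0) g = (SUP \<epsilon>\<in>{0<..}. g \<epsilon>)"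
  by (rule tendsto_Lim[OF _ tendsto_at_right_SUP]) (use assms in auto)

lemma span_number_antimono: "a \<le> b \<Longrightarrow> span_number X F n b \<le> span_number X F n a"
  unfolding span_number_def
  by (rule Inf_superset_mono) (force simp: orbit_spanning_def)

lemma sep_number_antimono: "a \<le> b \<Longrightarrow> sep_number X F n b \<le> sep_number X F n a"
  unfolding sep_number_def
  by (rule Sup_subset_mono) (force simp: orbit_separated_def)

lemma orbits_from_nonempty:
  assumes "top_dyn_system X F" "x \<in> X"
  shows "orbits_from X F n x \<noteq> {} \<or> n = 0"
proof (cases "n = 0")
  case False
  have "\<forall>y\<in>X. \<exists>z. z \<in> F y"
    using assms unfolding top_dyn_system_def by blast
  then obtain f where f: "\<And>y. y \<in> X \<Longrightarrow> f y \<in> F y"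
    by metis
  have X: "(f ^^ i) x \<in> X" for i
    using assms f by (induction i) (auto simp: top_dyn_system_def)
  have "map (\<lambda>i. (f ^^ i) x) [0..<n] \<in> orbits_from X F n x"
    using False X f by (auto simp: orbits_from_def)
  then show ?thesis by blast
qed simp

lemma orbit_dist_less_iff:
  "n > 0 \<Longrightarrow> orbit_dist n xs ys < e \<longleftrightarrow> (\<forall>i<n. dist (xs ! i) (ys ! i) < e)"
  unfolding orbit_dist_def by (subst Max_less_iff) auto

lemma orbit_dist_le_iff:
  "n > 0 \<Longrightarrow> orbit_dist n xs ys \<le> e \<longleftrightarrow> (\<forall>i<n. dist (xs ! i) (ys ! i) \<le> e)"
  unfolding orbit_dist_def by (subst Max_le_iff) auto

lemma orbit_dist_nonneg: "n > 0 \<Longrightarrow> orbit_dist n xs ys \<ge> 0"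
  unfolding orbit_dist_def by (subst Max_ge_iff) auto

lemma orbit_dist_commute: "orbit_dist n xs ys = orbit_dist n ys xs"
  by (simp add: orbit_dist_def dist_commute)

lemma orbit_dist_triangle_less:
  assumes "n > 0" "orbit_dist n xs zs < e" "orbit_dist n ys zs < e"
  shows "orbit_dist n xs ys < 2 * e"
proof -
  have "dist (xs ! i) (ys ! i) < 2 * e" if "i < n" for i
    using assms that dist_triangle2[of "xs ! i" "ys ! i" "zs ! i"]
    by (fastforce simp: orbit_dist_less_iff)
  then show ?thesis using assms(1) by (simp add: orbit_dist_less_iff)
qed

lemma orbit_semidist_refl:
  assumes "top_dyn_system X F" "x \<in> X" "n > 0"
  shows "orbit_semidist X F n x x \<le> 0"
proof -
  obtain xs where xs: "xs \<in> orbits_from X F n x"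
    using orbits_from_nonempty[OF assms(1,2), of n] assms(3) by auto
  have "orbit_semidist X F n x x \<le> orbit_dist n xs xs"
    unfolding orbit_semidist_def
    by (rule cInf_lower) (use xs assms(3) in \<open>auto intro!: bdd_belowI[of _ 0] orbit_dist_nonneg\<close>)
  also have "\<dots> \<le> 0"
    using assms(3) by (simp add: orbit_dist_le_iff)
  finally show ?thesis .
qed

lemma semidist_sep_number_antimono:
  assumes "top_dyn_system X F" "n > 0" "0 < a" "a \<le> b"
  shows "semidist_sep_number X F n b \<le> semidist_sep_number X F n a"
proof -
  have "semidist_separated X F n a E" if E: "semidist_separated X F n b E" for E
    unfolding semidist_separated_def
  proof (intro conjI ballI)
    show "E \<subseteq> X" using E by (simp add: semidist_separated_def)
    fix x assume x: "x \<in> E"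
    with \<open>E \<subseteq> X\<close> have "orbit_semidist X F n x x \<le> 0"
      using orbit_semidist_refl[OF assms(1) _ assms(2)] by blast
    with assms x \<open>E \<subseteq> X\<close> have "x \<in> orbit_semiball X F n x a"
      by (auto simp: orbit_semiball_def)
    moreover have "orbit_semiball X F n x a \<subseteq> orbit_semiball X F n x b"
      using assms by (auto simp: orbit_semiball_def)
    ultimately show "orbit_semiball X F n x a \<inter> E = {x}"
      using E x unfolding semidist_separated_def by blast
  qed
  then show ?thesis
    unfolding semidist_sep_number_def by (intro Sup_subset_mono) blast
qed

lemma sep_entropy_eq_SUP:
  assumes "top_dyn_system X F"
  shows "sep_entropy X F = (SUP \<epsilon>\<in>{0<..}. growth_rate (\<lambda>n. semidist_sep_number X F n \<epsilon>))"
  unfolding sep_entropy_def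
  by (rule Lim_at_right_SUP) (intro growth_rate_mono semidist_sep_number_antimono assms)

lemma top_entropy_eq_SUP:
  "top_entropy X F = (SUP \<epsilon>\<in>{0<..}. growth_rate (\<lambda>n. span_number X F n \<epsilon>))"
  unfolding top_entropy_def
  by (rule Lim_at_right_SUP) (intro growth_rate_mono span_number_antimono)

lemma ecard_mono_inj:
  assumes "inj_on f A" "f ` A \<subseteq> B"
  shows "ecard A \<le> ecard B"
proof (cases "finite B")
  case True
  then have "finite A" using assms finite_imageD finite_subset by blast
  then show ?thesis using True assms by (simp add: ecard_def card_inj_on_le)
qed (simp add: ecard_def)

lemma sep_number_le_span_number:
  assumes "n > 0"
  shows "sep_number X F n (2 * \<epsilon>) \<le> span_number X F n \<epsilon>"
  unfolding sep_number_def span_number_def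
proof (safe intro!: Sup_least Inf_greatest)
  fix E S assume E: "orbit_separated X F n (2 * \<epsilon>) E" and S: "orbit_spanning X F n \<epsilon> S"
  then obtain f where f: "\<And>xs. xs \<in> E \<Longrightarrow> f xs \<in> S \<and> orbit_dist n xs (f xs) < \<epsilon>"
    unfolding orbit_separated_def orbit_spanning_def by (metis subsetD)
  have "inj_on f E"
  proof (rule inj_onI)
    fix xs ys assume *: "xs \<in> E" "ys \<in> E" "f xs = f ys"
    then have "orbit_dist n xs ys < 2 * \<epsilon>"
      using f[of xs] f[of ys] by (intro orbit_dist_triangle_less[OF assms]) auto
    with * E show "xs = ys" unfolding orbit_separated_def by fastforce
  qed
  with f show "ecard E \<le> ecard S" by (intro ecard_mono_inj) auto
qed

lemma span_number_le_sep_number: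
  assumes "n > 0" "0 < \<delta>" "\<delta> < \<epsilon>"
  shows "span_number X F n \<epsilon> \<le> sep_number X F n \<delta>"
proof (cases "sep_number X F n \<delta>")
  case (enat m)
  let ?P = "\<lambda>E. orbit_separated X F n \<delta> E"
  have b: "finite E \<and> card E \<le> m" if "?P E" for E
  proof -
    have "ecard E \<le> enat m"
      unfolding enat[symmetric] sep_number_def by (rule Sup_upper) (use that in blast)
    then show ?thesis by (auto simp: ecard_def split: if_splits)
  qed
  have "?P {}" by (simp add: orbit_separated_def)
  moreover have "\<forall>E. ?P E \<longrightarrow> card E < Suc m" using b by (simp add: less_Suc_eq_le)
  ultimately obtain E where E: "?P E" and max: "\<And>E'. ?P E' \<Longrightarrow> card E' \<le> card E"
    using Lattices_Big.ex_has_greatest_nat[of ?P "{}" card "Suc m"] by metis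
  have "orbit_spanning X F n \<epsilon> E"
    unfolding orbit_spanning_def
  proof (intro conjI ballI)
    show "E \<subseteq> orbits X F n" using E by (simp add: orbit_separated_def)
    fix xs assume xs: "xs \<in> orbits X F n"
    show "\<exists>ys\<in>E. orbit_dist n xs ys < \<epsilon>"
    proof (rule ccontr)
      assume "\<not> ?thesis"
      then have far: "\<And>ys. ys \<in> E \<Longrightarrow> orbit_dist n xs ys \<ge> \<epsilon>" by (auto simp: not_less)
      have "orbit_dist n xs xs \<le> 0" using assms by (simp add: orbit_dist_le_iff)
      then have "xs \<notin> E" using far[of xs] assms by auto
      moreover have "?P (insert xs E)"
      proof -
        have "\<delta> < orbit_dist n xs ys" "\<delta> < orbit_dist n ys xs" if "ys \<in> E" for ys
          using far[OF that] assms(3) orbit_dist_commute[of n xs ys] by linarith+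
        then show ?thesis
          using E xs unfolding orbit_separated_def by blast
      qed
      ultimately show False
        using max[of "insert xs E"] b[OF E] by simp
    qed
  qed
  then have "span_number X F n \<epsilon> \<le> ecard E"
    unfolding span_number_def by (intro Inf_lower) blast
  also have "\<dots> \<le> sep_number X F n \<delta>"
    unfolding sep_number_def by (rule Sup_upper) (use E in blast)
  finally show ?thesis .
qed simp

lemma top_entropy_eq_separated:
  "top_entropy X F = Lim (at_right 0) (\<lambda>\<epsilon>. growth_rate (\<lambda>n. sep_number X F n \<epsilon>))"
proof -
  have "Lim (at_right 0) (\<lambda>\<epsilon>. growth_rate (\<lambda>n. sep_number X F n \<epsilon>)) =
        (SUP \<epsilon>\<in>{0<..}. growth_rate (\<lambda>n. sep_number X F n \<epsilon>))"
    by (rule Lim_at_right_SUP) (intro growth_rate_mono sep_number_antimono)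
  also have "\<dots> = (SUP \<epsilon>\<in>{0<..}. growth_rate (\<lambda>n. span_number X F n \<epsilon>))"
  proof (intro antisym SUP_mono)
    fix e :: real assume e: "e \<in> {0<..}"
    have "growth_rate (\<lambda>n. sep_number X F n e) \<le> growth_rate (\<lambda>n. span_number X F n (e / 2))"
      using sep_number_le_span_number[where \<epsilon> = "e / 2" and X = X and F = F]
      by (intro growth_rate_mono) simp
    then show "\<exists>d\<in>{0<..}. growth_rate (\<lambda>n. sep_number X F n e) \<le> growth_rate (\<lambda>n. span_number X F n d)"
      using e by (intro bexI[of _ "e / 2"]) auto
    have "growth_rate (\<lambda>n. span_number X F n e) \<le> growth_rate (\<lambda>n. sep_number X F n (e / 2))"
      using e by (intro growth_rate_mono span_number_le_sep_number) auto
    then show "\<exists>d\<in>{0<..}. growth_rate (\<lambda>n. span_number X F n e) \<le> growth_rate (\<lambda>n. sep_number X F n d)"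
      using e by (intro bexI[of _ "e / 2"]) auto
  qed
  finally show ?thesis by (simp add: top_entropy_eq_SUP)
qed

end

theory Submission
  imports Defs
begin

text \<open>The semidistance of two points is an infimum over pairs of orbits, so it is at most the
  distance of any one such pair. Choose one orbit of length n from each point of a separated set:
  the chosen orbits are then separated at the same scale and equally numerous. Hence S_n(\<epsilon>)
  \<le> s_n(\<epsilon>) for n > 0 (\<open>semidist_sep_number_le_sep_number\<close>), and growth
  rates and limits inherit the inequality.\<close>

lemma orbit_semidist_le:
  assumes "n > 0" "xs \<in> orbits_from X F n x" "ys \<in> orbits_from X F n y"
  shows "orbit_semidist X F n x y \<le> orbit_dist n xs ys"
  unfolding orbit_semidist_def
  \<comment> \<open>A real \<open>Inf\<close> bounds its set from below only if the set has a lower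
    bound; 0 is one, as n > 0 makes \<open>orbit_dist\<close> a maximum over a nonempty index
    set.\<close>
  by (rule cInf_lower) (use assms in \<open>auto intro!: bdd_belowI[of _ 0] orbit_dist_nonneg\<close>)

lemma semidist_sep_number_le_sep_number:
  assumes "top_dyn_system X F" "n > 0"
  shows "semidist_sep_number X F n \<epsilon> \<le> sep_number X F n \<epsilon>"
  unfolding semidist_sep_number_def
proof (safe intro!: Sup_least)
  fix E assume E: "semidist_separated X F n \<epsilon> E"
  then have "E \<subseteq> X" by (simp add: semidist_separated_def)
  then have "\<forall>x\<in>E. \<exists>xs. xs \<in> orbits_from X F n x"
    using orbits_from_nonempty[OF assms(1)] assms(2) by blast
  then obtain f where f: "\<And>x. x \<in> E \<Longrightarrow> f x \<in> orbits_from X F n x"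
    by metis
  have "inj_on f E"
  \<comment> \<open>The chosen orbit remembers its starting point as entry 0, so taking that entry
    inverts \<open>f\<close>.\<close>
  proof (rule inj_on_inverseI)
    show "f x ! 0 = x" if "x \<in> E" for x
      using f[OF that] by (simp add: orbits_from_def)
  qed
  have "orbit_dist n (f x) (f y) > \<epsilon>" if "x \<in> E" "y \<in> E" "x \<noteq> y" for x y
  proof -
    have "orbit_semiball X F n x \<epsilon> \<inter> E = {x}"
      using E that(1) by (simp add: semidist_separated_def)
    then have "y \<notin> orbit_semiball X F n x \<epsilon>"
      using that(2,3) by (metis IntI singletonD)
    moreover have "y \<in> X"
      using that(2) \<open>E \<subseteq> X\<close> by blast
    ultimately have "\<epsilon> < orbit_semidist X F n x y"
      by (simp add: orbit_semiball_def)
    also have "\<dots> \<le> orbit_dist n (f x) (f y)"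
      by (rule orbit_semidist_le[OF assms(2) f[OF that(1)] f[OF that(2)]])
    finally show ?thesis .
  qed
  moreover have "f x \<in> orbits X F n" if "x \<in> E" for x
    unfolding orbits_def using f[OF that] \<open>E \<subseteq> X\<close> that by blast
  ultimately have "orbit_separated X F n \<epsilon> (f ` E)"
    unfolding orbit_separated_def by auto
  then have "ecard (f ` E) \<le> sep_number X F n \<epsilon>"
    unfolding sep_number_def by (intro Sup_upper) blast
  with ecard_mono_inj[OF \<open>inj_on f E\<close> order_refl]
  show "ecard E \<le> sep_number X F n \<epsilon>" by (rule order_trans)
qed

theorem theorem4p1:
  fixes X :: "'a::metric_space set" and F :: "'a \<Rightarrow> 'a set"
  assumes "top_dyn_system X F"
  shows "sep_entropy X F \<le> top_entropy X F"
proof -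
  have "sep_entropy X F \<le> (SUP \<epsilon>\<in>{0<..}. growth_rate (\<lambda>n. sep_number X F n \<epsilon>))"
    \<comment> \<open>Both limits at 0 are suprema over \<epsilon> > 0, by monotonicity in
      \<epsilon>, so comparing at each fixed \<epsilon> suffices.\<close>
    unfolding sep_entropy_eq_SUP[OF assms]
    by (rule SUP_mono') (intro growth_rate_mono semidist_sep_number_le_sep_number assms)
  also have "\<dots> = top_entropy X F"
    unfolding top_entropy_eq_separated
    by (rule Lim_at_right_SUP[symmetric]) (intro growth_rate_mono sep_number_antimono)
  finally show ?thesis .
qed

end
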